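(* Let $f\colon\mathbb{R}^d\to\mathbb{R}$ be $\mu$-strongly convex and $L$-smooth ($\mu>0$), and let $\mathtt{Alg}$ be a procedure as in the context. Fix $x_{\rm in}\in\mathbb{R}^d$, a constant $\Delta_{\rm in}>0$ with $\Delta_{\rm in}\ge f(x_{\rm in})-\min f$, $\delta>0$, natural numbers $T,m$, and penalties $0\le\lambda_0\le\dots\le\lambda_T$ (with $\lambda_{-1}:=0$). Then with probability at least $1-(T+2)\exp\left(-\frac{m}{18}\right)$, the point $x_{T+1}=\mathtt{BoostAlg}(\delta,\Delta_{\rm in},x_{\rm in},T,m)$ (defined in the context) satisfies $$f(x_{T+1})-\min f\le\delta\left(1+\sum_{i=0}^{T}\frac{\lambda_i}{\mu+\lambda_{i-1}}\right).$$
   Context: $\mu$-strongly convex means $f-\frac\mu2\|\cdot\|^2$ is convex; $L$-smooth means differentiable with $L$-Lipschitz gradient. $\mathtt{Alg}$: for $x\in\mathbb{R}^d$, $\lambda\ge0$ let $\varphi_x(y)=f(y)+\frac\lambda2\|y-x\|^2$. $\mathtt{Alg}(\delta,\lambda,\Delta,x)$ is a randomized procedure such that, whenever $\delta>0$ and $\Delta>0$ satisfies $\varphi_x(x)-\min\varphi_x\le\Delta$, it returns a point $y$ with $\mathbb{P}[\varphi_x(y)-\min\varphi_x\le\delta]\ge\frac23$. Different calls use fresh independent randomness. $\mathtt{Alg\text{-}R}(\delta,\lambda,\Delta,x,m)$: call $\mathtt{Alg}(\delta,\lambda,\Delta,x)$ independently $m$ times to get $y_1,\dots,y_m$; for each $i$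 let $r_i$ be the smallest $r\ge0$ such that more than $m/2$ indices $k$ satisfy $\|y_k-y_i\|\le r$; return $y_{i^*}$ where $i^*$ minimizes $r_i$. $\mathtt{BoostAlg}(\delta,\Delta_{\rm in},x_{\rm in},T,m)$: set $\lambda_{-1}=0$, $\Delta_{-1}=\Delta_{\rm in}$, $x_{-1}=x_{\rm in}$. For $j=0,\dots,T$: set $$x_j=\mathtt{Alg\text{-}R}(\delta/9,\lambda_{j-1},\Delta_{j-1},x_{j-1},m),\qquad \Delta_j=\delta\left(\frac{L+\lambda_{j-1}}{\mu+\lambda_{j-1}}+\sum_{i=0}^{j-1}\frac{\lambda_i}{\mu+\lambda_{i-1}}\right).$$ Return $x_{T+1}=\mathtt{Alg\text{-}R}\left(\frac{\mu+\lambda_T}{L+\lambda_T}\cdot\frac\delta9,\lambda_T,\Delta_T,x_T,m\right)$. *)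

theory Defs
  imports "HOL-Probability.Probability"
begin

definition strongly_convex :: "real \<Rightarrow> ('a::euclidean_space \<Rightarrow> real) \<Rightarrow> bool" where
  "strongly_convex \<mu> f \<longleftrightarrow> convex_on UNIV (\<lambda>x. f x - \<mu> / 2 * (norm x)\<^sup>2)"

definition smooth :: "real \<Rightarrow> ('a::euclidean_space \<Rightarrow> real) \<Rightarrow> bool" where
  "smooth L f \<longleftrightarrow> (\<exists>g. (\<forall>x. GDERIV f x :> g x) \<and> L-lipschitz_on UNIV g)"

(* The minimum of f; it is attained for the strongly convex, differentiable functions
   to which it is applied. *)
definition min_val :: "('a \<Rightarrow> real) \<Rightarrow> real" where
  "min_val f = (LEAST v. v \<in> range f)"

definition prox :: "('a::euclidean_space \<Rightarrow> real) \<Rightarrow> real \<Rightarrow> 'a \<Rightarrow> 'a \<Rightarrow> real" where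
  "prox f lam x y = f y + lam / 2 * (norm (y - x))\<^sup>2"

(* A randomized procedure is represented by the law of its output, as a function of the input.
   Dependence on the point x has to be measurable (a Markov kernel), because in BoostAlg
   the procedure is called at random points. *)
type_synonym 'a rand_proc = "real \<Rightarrow> real \<Rightarrow> real \<Rightarrow> 'a \<Rightarrow> 'a measure"

definition is_Alg :: "('a::euclidean_space \<Rightarrow> real) \<Rightarrow> 'a rand_proc \<Rightarrow> bool" where
  "is_Alg f Alg \<longleftrightarrow>
     (\<forall>\<delta> lam \<Delta>. \<delta> > 0 \<longrightarrow> lam \<ge> 0 \<longrightarrow> \<Delta> > 0 \<longrightarrow>
        Alg \<delta> lam \<Delta> \<in> borel \<rightarrow>\<^sub>M prob_algebra borel \<and>
        (\<forall>x. prox f lam x x - min_val (prox f lam x) \<le> \<Delta> \<longrightarrow>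
           measure (Alg \<delta> lam \<Delta> x) {y. prox f lam x y - min_val (prox f lam x) \<le> \<delta>} \<ge> 2 / 3))"

definition radius :: "nat \<Rightarrow> (nat \<Rightarrow> 'a::euclidean_space) \<Rightarrow> nat \<Rightarrow> real" where
  "radius m y i =
     (LEAST r. r \<ge> 0 \<and> real (card {k. k < m \<and> norm (y k - y i) \<le> r}) > real m / 2)"

(* The m samples are indexed by 0, ..., m - 1.  ARG_MIN leaves open which of several
   minimizing indices is taken. *)
definition select :: "nat \<Rightarrow> (nat \<Rightarrow> 'a::euclidean_space) \<Rightarrow> 'a" where
  "select m y = y (ARG_MIN (radius m y) i. i < m)"

(* The product measure is the joint law of the m independent calls. *)
definition Alg_R ::
  "'a::euclidean_space rand_proc \<Rightarrow> real \<Rightarrow> real \<Rightarrow> real \<Rightarrow> 'a \<Rightarrow> nat \<Rightarrow> 'a measure" where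
  "Alg_R Alg \<delta> lam \<Delta> x m =
     distr (PiM {..<m} (\<lambda>_. Alg \<delta> lam \<Delta> x)) borel (select m)"

(* The sequences of the algorithm start at index -1; prev a s j is the entry with
   index j - 1 of the sequence s extended by the entry a at index -1. *)
definition prev :: "'b \<Rightarrow> (nat \<Rightarrow> 'b) \<Rightarrow> nat \<Rightarrow> 'b" where
  "prev a s j = (case j of 0 \<Rightarrow> a | Suc i \<Rightarrow> s i)"

definition boost_gap :: "real \<Rightarrow> real \<Rightarrow> (nat \<Rightarrow> real) \<Rightarrow> real \<Rightarrow> nat \<Rightarrow> real" where
  "boost_gap \<mu> L lam \<delta> j =
     \<delta> * ((L + prev 0 lam j) / (\<mu> + prev 0 lam j) + (\<Sum>i<j. lam i / (\<mu> + prev 0 lam i)))"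

(* boost_iter ... j is the law of the iterate with index j - 1.  Given that iterate, the Giry bind
   draws the next one from Alg_R with fresh randomness. *)
primrec boost_iter ::
  "'a::euclidean_space rand_proc \<Rightarrow> real \<Rightarrow> real \<Rightarrow> (nat \<Rightarrow> real) \<Rightarrow> real \<Rightarrow> real \<Rightarrow> 'a \<Rightarrow> nat
    \<Rightarrow> nat \<Rightarrow> 'a measure" where
  "boost_iter Alg \<mu> L lam \<delta> \<Delta>in xin m 0 = return borel xin"
| "boost_iter Alg \<mu> L lam \<delta> \<Delta>in xin m (Suc j) =
     boost_iter Alg \<mu> L lam \<delta> \<Delta>in xin m j \<bind>
       (\<lambda>x. Alg_R Alg (\<delta> / 9) (prev 0 lam j) (prev \<Delta>in (boost_gap \<mu> L lam \<delta>) j) x m)"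

definition BoostAlg ::
  "'a::euclidean_space rand_proc \<Rightarrow> real \<Rightarrow> real \<Rightarrow> (nat \<Rightarrow> real) \<Rightarrow> real \<Rightarrow> real \<Rightarrow> 'a \<Rightarrow> nat
    \<Rightarrow> nat \<Rightarrow> 'a measure" where
  "BoostAlg Alg \<mu> L lam \<delta> \<Delta>in xin T m =
     boost_iter Alg \<mu> L lam \<delta> \<Delta>in xin m (Suc T) \<bind>
       (\<lambda>x. Alg_R Alg ((\<mu> + lam T) / (L + lam T) * (\<delta> / 9)) (lam T) (boost_gap \<mu> L lam \<delta> T) x m)"

end

theory Submission
  imports Defs
begin

text \<open>Two samples that both have more than half of all samples in a ball around them share a
  sample, so if more than half of the \<open>m\<close> outputs are within \<open>e\<close> of the exact minimizer \<open>z\<close>, the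
  selected one is within \<open>3 * e\<close> of it; by Hoeffding's inequality this fails with probability at
  most \<open>exp (- m / 18)\<close>.  Writing \<open>z\<^sub>j\<close> for the exact minimizer approximated by \<open>x\<^sub>j\<close> and \<open>\<phi>\<^sub>j\<close>
  for the function regularized at \<open>x\<^sub>j\<close> with penalty \<open>\<lambda>\<^sub>j\<close>, one has
  \<open>min \<phi>\<^sub>j \<le> \<phi>\<^sub>j z\<^sub>j \<le> min \<phi>\<^sub>j\<^sub>-\<^sub>1 + \<lambda>\<^sub>j / 2 * \<parallel>z\<^sub>j - x\<^sub>j\<parallel>\<^sup>2\<close>, and these errors add up along the run.  Smoothness
  is used to pass from the distance \<open>\<parallel>z\<^sub>j - x\<^sub>j\<parallel>\<close> back to the value at \<open>x\<^sub>j\<close>.\<close>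

subsection \<open>Strongly convex smooth functions and their regularizations\<close>

lemma GDERIV_along_line:
  assumes "GDERIV f (x + t *\<^sub>R d) :> g"
  shows "((\<lambda>t. f (x + t *\<^sub>R d)) has_field_derivative inner g d) (at t)"
proof -
  have "((\<lambda>t. x + t *\<^sub>R d) has_derivative (\<lambda>t. t *\<^sub>R d)) (at t)"
    by (auto intro!: derivative_eq_intros)
  then have "((\<lambda>t. f (x + t *\<^sub>R d)) has_derivative (\<lambda>s. inner (s *\<^sub>R d) g)) (at t)"
    using assms unfolding gderiv_def by (rule has_derivative_compose)
  then show ?thesis
    by (simp add: has_field_derivative_def inner_commute mult_commute_abs)
qed

text \<open>Along the line through \<open>x\<close> and \<open>y\<close> the convex function
  \<open>h\<close> lies above its tangent at parameter 0. Expanding the square norm of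
  \<open>x + d\<close> turns this into the claim, the term
  \<open>\<mu> / 2 * (norm d)\<^sup>2\<close> being what the subtracted quadratic leaves
  over.\<close>

lemma strongly_convex_above_tangent:
  fixes f :: "'a::euclidean_space \<Rightarrow> real"
  assumes "strongly_convex \<mu> f" and "GDERIV f x :> g"
  shows "f x + inner g (y - x) + \<mu> / 2 * (norm (y - x))\<^sup>2 \<le> f y"
proof -
  define d where "d = y - x"
  define h where "h = (\<lambda>z. f z - \<mu> / 2 * (norm z)\<^sup>2)"
  have conv: "convex_on UNIV h"
    using assms(1) by (simp add: strongly_convex_def h_def)
  have "convex_on UNIV (\<lambda>t::real. h (x + t *\<^sub>R d))"
  proof (rule convex_onI)
    fix t a b :: real assume t: "0 < t" "t < 1"
    have "x + ((1 - t) *\<^sub>R a + t *\<^sub>R b) *\<^sub>R d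
        = (1 - t) *\<^sub>R (x + a *\<^sub>R d) + t *\<^sub>R (x + b *\<^sub>R d)"
      by (simp add: algebra_simps)
    then show "h (x + ((1 - t) *\<^sub>R a + t *\<^sub>R b) *\<^sub>R d)
        \<le> (1 - t) * h (x + a *\<^sub>R d) + t * h (x + b *\<^sub>R d)"
      using convex_onD[OF conv, of t "x + a *\<^sub>R d" "x + b *\<^sub>R d"] t by simp
  qed simp
  moreover have "((\<lambda>t. h (x + t *\<^sub>R d)) has_field_derivative inner g d - \<mu> * inner x d) (at 0)"
  proof -
    have "((\<lambda>t. f (x + t *\<^sub>R d)) has_field_derivative inner g d) (at 0)"
      using assms(2) by (intro GDERIV_along_line) simp
    moreover have "((\<lambda>t. \<mu> / 2 * (norm (x + t *\<^sub>R d))\<^sup>2) has_field_derivative \<mu> * inner x d) (at 0)"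
      unfolding power2_norm_eq_inner inner_add_left inner_add_right
      by (auto intro!: derivative_eq_intros simp: inner_commute)
    ultimately show ?thesis
      unfolding h_def by (rule DERIV_diff)
  qed
  ultimately have "h (x + 1 *\<^sub>R d) - h (x + 0 *\<^sub>R d) \<ge> (inner g d - \<mu> * inner x d) * (1 - 0)"
    by (intro convex_on_imp_above_tangent[where A = UNIV]) auto
  moreover have "\<mu> / 2 * (norm y)\<^sup>2 = \<mu> / 2 * (norm x)\<^sup>2 + \<mu> * inner x d + \<mu> / 2 * (norm d)\<^sup>2"
    unfolding d_def power2_norm_eq_inner inner_diff_left inner_diff_right
    by (simp add: inner_commute field_simps)
  ultimately show ?thesis
    by (simp add: h_def d_def add_divide_distrib)
qed

text \<open>The descent lemma. Subtracting the quadratic model from \<open>f\<close> along the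
  segment leaves a function \<open>h\<close> whose derivative is nonpositive, by Cauchy-Schwarz and
  the Lipschitz bound on the gradient.\<close>

lemma lipschitz_gradient_upper_bound:
  fixes f :: "'a::euclidean_space \<Rightarrow> real"
  assumes deriv: "\<And>x. GDERIV f x :> g x" and lip: "L-lipschitz_on UNIV g"
  shows "f y \<le> f x + inner (g x) (y - x) + L / 2 * (norm (y - x))\<^sup>2"
proof -
  define d where "d = y - x"
  define h where "h = (\<lambda>t::real. f (x + t *\<^sub>R d) - t * inner (g x) d - L / 2 * t\<^sup>2 * (norm d)\<^sup>2)"
  have "h 1 \<le> h 0"
  proof (rule DERIV_nonpos_imp_nonincreasing[of 0 1 h])
    fix t :: real assume t: "0 \<le> t" "t \<le> 1"
    have "(h has_field_derivative
        (inner (g (x + t *\<^sub>R d)) d - inner (g x) d - L * t * (norm d)\<^sup>2)) (at t)"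
      unfolding h_def by (auto intro!: derivative_eq_intros GDERIV_along_line deriv)
    moreover have "inner (g (x + t *\<^sub>R d)) d - inner (g x) d \<le> L * t * (norm d)\<^sup>2"
    proof -
      have "inner (g (x + t *\<^sub>R d)) d - inner (g x) d = inner (g (x + t *\<^sub>R d) - g x) d"
        by (simp add: inner_diff_left)
      also have "\<dots> \<le> norm (g (x + t *\<^sub>R d) - g x) * norm d"
        by (rule norm_cauchy_schwarz)
      also have "\<dots> \<le> (L * (t * norm d)) * norm d"
        using lipschitz_onD[OF lip, of "x + t *\<^sub>R d" x] t
        by (intro mult_right_mono) (auto simp: dist_norm)
      finally show ?thesis by (simp add: power2_eq_square mult_ac)
    qed
    ultimately show "\<exists>D. (h has_field_derivative D) (at t) \<and> D \<le> 0"
      by (intro exI conjI) auto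
  qed simp
  then show ?thesis
    by (simp add: h_def d_def add_divide_distrib)
qed

lemma smooth_imp_continuous_on:
  assumes "smooth L f"
  shows "continuous_on UNIV f"
  using assms unfolding smooth_def gderiv_def continuous_on_eq_continuous_at[OF open_UNIV]
  by (meson has_derivative_continuous)

lemma min_val_eqI:
  assumes "\<And>y. f z \<le> f y"
  shows "min_val f = f z"
  unfolding min_val_def by (rule Least_equality) (use assms in auto)

text \<open>\<open>min_val\<close> is a \<open>LEAST\<close> over the reals, so attainment has to be
  shown before it means anything. The two quadratic bounds around the minimizer are the form in
  which strong convexity and smoothness are used from here on.\<close>

lemma exists_minimizer:
  fixes f :: "'a::euclidean_space \<Rightarrow> real"
  assumes "\<mu> > 0" "strongly_convex \<mu> f" "smooth L f"
  obtains z where "min_val f = f z"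
    and "\<And>y. \<mu> / 2 * (norm (y - z))\<^sup>2 \<le> f y - f z"
    and "\<And>y. f y - f z \<le> L / 2 * (norm (y - z))\<^sup>2"
proof -
  obtain g where deriv: "\<And>x. GDERIV f x :> g x" and lip: "L-lipschitz_on UNIV g"
    using assms(3) by (auto simp: smooth_def)
  have "continuous_on UNIV f"
    using assms(3) by (rule smooth_imp_continuous_on)
  \<comment> \<open>Outside the ball of this radius the quadratic term of the tangent bound at 0
    outweighs its linear term, so \<open>f y\<close> is at least \<open>f 0\<close>, and the minimum
    over the compact ball is global.\<close>
  define r where "r = 2 * norm (g 0) / \<mu>"
  have "r \<ge> 0" using assms(1) by (simp add: r_def)
  obtain z where z: "\<And>y. y \<in> cball 0 r \<Longrightarrow> f z \<le> f y"
    using continuous_attains_inf[of "cball 0 r" f] \<open>continuous_on UNIV f\<close> \<open>r \<ge> 0\<close>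
      continuous_on_subset by (metis cball_eq_empty compact_cball not_less subset_UNIV)
  have min: "f z \<le> f y" for y
  proof (cases "norm y \<le> r")
    case False
    have "- (norm (g 0) * norm y) \<le> inner (g 0) y"
      using Cauchy_Schwarz_ineq2[of "g 0" y] by linarith
    moreover have "norm (g 0) * norm y \<le> \<mu> / 2 * (norm y)\<^sup>2"
      using mult_right_mono[of r "norm y" "norm y * \<mu> / 2"] False assms(1)
      by (simp add: r_def power2_eq_square mult_ac)
    moreover have "f 0 + inner (g 0) y + \<mu> / 2 * (norm y)\<^sup>2 \<le> f y"
      using strongly_convex_above_tangent[OF assms(2) deriv, of 0 y] by simp
    ultimately show ?thesis
      using z[of 0] \<open>r \<ge> 0\<close> by simp
  qed (use z in auto)
  \<comment> \<open>With zero gradient at \<open>z\<close>, the tangent bound and the descent bound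
    centred there lose their linear terms.\<close>
  have "g z = 0"
  proof -
    have "(\<lambda>v. inner v (g z)) = (\<lambda>v. 0)"
      using deriv[of z] min by (intro differential_zero_maxmin[of z UNIV f]) (auto simp: gderiv_def)
    then have "inner (g z) (g z) = 0" by metis
    then show ?thesis by simp
  qed
  show thesis
  proof (rule that)
    show "min_val f = f z" by (rule min_val_eqI) (rule min)
    show "\<mu> / 2 * (norm (y - z))\<^sup>2 \<le> f y - f z" for y
      using strongly_convex_above_tangent[OF assms(2) deriv, of z y] \<open>g z = 0\<close> by simp
    show "f y - f z \<le> L / 2 * (norm (y - z))\<^sup>2" for y
      using lipschitz_gradient_upper_bound[OF deriv lip, of y z] \<open>g z = 0\<close> by simp
  qed
qed

lemma min_val_le:
  fixes f :: "'a::euclidean_space \<Rightarrow> real"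
  assumes "\<mu> > 0" "strongly_convex \<mu> f" "smooth L f"
  shows "min_val f \<le> f y"
proof -
  obtain z where "min_val f = f z" "\<mu> / 2 * (norm (y - z))\<^sup>2 \<le> f y - f z"
    using exists_minimizer[OF assms] by metis
  moreover have "0 \<le> \<mu> / 2 * (norm (y - z))\<^sup>2"
    using assms(1) by simp
  ultimately show ?thesis by linarith
qed

text \<open>The lower quadratic at the minimizer cannot exceed the upper one, and a basis vector
  gives a point where they can be compared. This supplies \<open>L > 0\<close> for the denominators
  below.\<close>

lemma strongly_convex_smooth_le:
  fixes f :: "'a::euclidean_space \<Rightarrow> real"
  assumes "\<mu> > 0" "strongly_convex \<mu> f" "smooth L f"
  shows "\<mu> \<le> L"
proof -
  obtain z where lower: "\<And>y. \<mu> / 2 * (norm (y - z))\<^sup>2 \<le> f y - f z"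
    and upper: "\<And>y. f y - f z \<le> L / 2 * (norm (y - z))\<^sup>2"
    using exists_minimizer[OF assms] by blast
  obtain b :: 'a where "b \<in> Basis"
    using nonempty_Basis by blast
  have "\<mu> / 2 * (norm b)\<^sup>2 \<le> L / 2 * (norm b)\<^sup>2"
    using lower[of "z + b"] upper[of "z + b"] by simp
  with \<open>b \<in> Basis\<close> show ?thesis by simp
qed

lemma strongly_convex_prox:
  fixes f :: "'a::euclidean_space \<Rightarrow> real"
  assumes "strongly_convex \<mu> f"
  shows "strongly_convex (\<mu> + l) (prox f l x)"
proof -
  \<comment> \<open>Once the enlarged quadratic is removed, the penalty contributes only an affine
    function of \<open>y\<close>.\<close>
  have "(\<lambda>y. prox f l x y - (\<mu> + l) / 2 * (norm y)\<^sup>2)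
      = (\<lambda>y. (f y - \<mu> / 2 * (norm y)\<^sup>2) + (l / 2 * (norm x)\<^sup>2 - l * inner x y))"
    by (rule ext) (simp add: prox_def power2_norm_eq_inner inner_diff_left inner_diff_right
        inner_commute field_simps)
  moreover have "convex_on UNIV (\<lambda>y. c - l * inner x y)" for c
    by (rule convex_onI) (auto simp: inner_add_right algebra_simps)
  ultimately show ?thesis
    using assms by (simp add: strongly_convex_def convex_on_add)
qed

lemma smooth_prox:
  fixes f :: "'a::euclidean_space \<Rightarrow> real"
  assumes "smooth L f" "l \<ge> 0"
  shows "smooth (L + l) (prox f l x)"
proof -
  obtain g where deriv: "\<And>x. GDERIV f x :> g x" and lip: "L-lipschitz_on UNIV g"
    using assms(1) by (auto simp: smooth_def)
  have "GDERIV (\<lambda>y. l / 2 * (norm (y - x))\<^sup>2) y :> l *\<^sub>R (y - x)" for y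
    unfolding gderiv_def power2_norm_eq_inner
    by (auto intro!: derivative_eq_intros simp: inner_commute algebra_simps)
  then have "GDERIV (prox f l x) y :> g y + l *\<^sub>R (y - x)" for y
    using GDERIV_add[OF deriv] by (simp add: prox_def[abs_def])
  moreover have "(L + l)-lipschitz_on UNIV (\<lambda>y. g y + l *\<^sub>R (y - x))"
    by (intro lipschitz_on_add lip lipschitz_onI)
      (use assms(2) in \<open>auto simp: dist_norm algebra_simps simp flip: scaleR_diff_right\<close>)
  ultimately show ?thesis
    unfolding smooth_def by (intro exI[of _ "\<lambda>y. g y + l *\<^sub>R (y - x)"]) auto
qed

lemma prox_minimizer:
  fixes f :: "'a::euclidean_space \<Rightarrow> real"
  assumes "\<mu> > 0" "strongly_convex \<mu> f" "smooth L f" "l \<ge> 0"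
  obtains z where "min_val (prox f l x) = prox f l x z"
    and "\<And>y. (\<mu> + l) / 2 * (norm (y - z))\<^sup>2 \<le> prox f l x y - prox f l x z"
    and "\<And>y. prox f l x y - prox f l x z \<le> (L + l) / 2 * (norm (y - z))\<^sup>2"
  using exists_minimizer[of "\<mu> + l" "prox f l x" "L + l"]
    strongly_convex_prox[OF assms(2)] smooth_prox[OF assms(3,4)] assms(1,4)
  by (metis add_pos_nonneg)

lemma min_val_prox_le:
  fixes f :: "'a::euclidean_space \<Rightarrow> real"
  assumes "\<mu> > 0" "strongly_convex \<mu> f" "smooth L f" "l \<ge> 0"
  shows "min_val (prox f l x) \<le> prox f l x y"
  using min_val_le[of "\<mu> + l" "prox f l x" "L + l"]
    strongly_convex_prox[OF assms(2)] smooth_prox[OF assms(3,4)] assms(1,4)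
  by simp

text \<open>Since \<open>prox f l x x = f x\<close>, this makes every bound on the gap of
  \<open>f\<close> at \<open>x\<close> a valid input bound for a call of \<open>Alg\<close> on the
  regularized function.\<close>

lemma min_val_le_min_val_prox:
  fixes f :: "'a::euclidean_space \<Rightarrow> real"
  assumes "\<mu> > 0" "strongly_convex \<mu> f" "smooth L f" "l \<ge> 0"
  shows "min_val f \<le> min_val (prox f l x)"
proof -
  obtain z where z: "min_val (prox f l x) = prox f l x z"
    using prox_minimizer[OF assms] by metis
  have "min_val f \<le> f z" using min_val_le[OF assms(1-3)] .
  also have "\<dots> \<le> prox f l x z" using assms(4) by (simp add: prox_def)
  finally show ?thesis using z by simp
qed

text \<open>The invariant of the iteration bounds a regularized minimum whose centre is random, so
  this minimum must depend measurably on the centre.\<close>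

lemma min_val_prox_measurable:
  fixes f :: "'a::euclidean_space \<Rightarrow> real"
  assumes "\<mu> > 0" "strongly_convex \<mu> f" "smooth L f" "l \<ge> 0"
  shows "(\<lambda>x. min_val (prox f l x)) \<in> borel_measurable borel"
proof (subst borel_measurable_iff_less, intro allI)
  fix c :: real
  \<comment> \<open>A pointwise infimum of continuous functions is upper semicontinuous.\<close>
  have "min_val (prox f l x) < c \<longleftrightarrow> (\<exists>y. prox f l x y < c)" for x
  proof -
    obtain z where z: "min_val (prox f l x) = prox f l x z"
      using prox_minimizer[OF assms] by metis
    then show ?thesis
      using min_val_prox_le[OF assms, of x] by (metis le_less_trans)
  qed
  then have "{x \<in> space borel. min_val (prox f l x) < c} = (\<Union>y. {x. prox f l x y < c})"
    by auto
  also have "open \<dots>"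
    by (intro open_UN ballI open_Collect_less) (auto simp: prox_def intro!: continuous_intros)
  finally show "{x \<in> space borel. min_val (prox f l x) < c} \<in> sets borel"
    by simp
qed

subsection \<open>Selection of a central sample\<close>

text \<open>As soon as one radius is admissible, the \<open>LEAST\<close> defining
  \<open>radius\<close> is attained, because finitely many candidate radii suffice.\<close>

lemma radius_bounds:
  fixes y :: "nat \<Rightarrow> 'a::euclidean_space"
  assumes "r \<ge> 0" "real (card {k. k < m \<and> norm (y k - y i) \<le> r}) > real m / 2"
  shows "0 \<le> radius m y i" "radius m y i \<le> r"
    and "real (card {k. k < m \<and> norm (y k - y i) \<le> radius m y i}) > real m / 2"
proof -
  define P where "P = (\<lambda>r. r \<ge> 0 \<and> real (card {k. k < m \<and> norm (y k - y i) \<le> r}) > real m / 2)"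
  \<comment> \<open>Only the finitely many radii below matter, since lowering \<open>s\<close> to the largest
    distance it covers does not change the index set.\<close>
  define D where "D = insert 0 ((\<lambda>k. norm (y k - y i)) ` {..<m})"
  have "finite D" by (simp add: D_def)
  have shrink: "\<exists>t\<in>D. t \<le> s \<and> P t" if "P s" for s
  proof -
    define t where "t = Max {d \<in> D. d \<le> s}"
    have ne: "{d \<in> D. d \<le> s} \<noteq> {}" and fin: "finite {d \<in> D. d \<le> s}"
      using that \<open>finite D\<close> by (auto simp: P_def D_def)
    have t: "t \<in> D" "t \<le> s"
      using Max_in[OF fin ne] by (auto simp: t_def)
    have le_t: "d \<le> t" if "d \<in> D" "d \<le> s" for d
      using Max_ge[OF fin] that by (simp add: t_def)
    have "{k. k < m \<and> norm (y k - y i) \<le> t} = {k. k < m \<and> norm (y k - y i) \<le> s}"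
      using t le_t by (auto simp: D_def)
    moreover have "0 \<le> t"
      using le_t[of 0] that by (auto simp: D_def P_def)
    ultimately show ?thesis
      using t that by (auto simp: P_def)
  qed
  define r0 where "r0 = Min {d \<in> D. P d}"
  have fin: "finite {d \<in> D. P d}" using \<open>finite D\<close> by simp
  have "P r" using assms by (simp add: P_def)
  then have ne: "{d \<in> D. P d} \<noteq> {}" using shrink by blast
  have "P r0"
    using Min_in[OF fin ne] by (simp add: r0_def)
  have least: "r0 \<le> s" if "P s" for s
  proof -
    obtain t where "t \<in> D" "t \<le> s" "P t" using shrink \<open>P s\<close> by blast
    with Min_le[OF fin, of t] show ?thesis by (simp add: r0_def)
  qed
  have "radius m y i = r0"
    unfolding radius_def P_def[symmetric] by (rule Least_equality) (use \<open>P r0\<close> least in auto)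
  with \<open>P r0\<close> \<open>P r\<close> least show "0 \<le> radius m y i" "radius m y i \<le> r"
    "real (card {k. k < m \<and> norm (y k - y i) \<le> radius m y i}) > real m / 2"
    by (auto simp: P_def)
qed

text \<open>The sum of all distances is a radius that covers all \<open>m\<close> samples.\<close>

lemma radius_ex:
  fixes y :: "nat \<Rightarrow> 'a::euclidean_space"
  assumes "m > 0"
  shows "\<exists>r\<ge>0. real (card {k. k < m \<and> norm (y k - y i) \<le> r}) > real m / 2"
proof (intro exI conjI)
  let ?r = "\<Sum>k<m. norm (y k - y i)"
  show "0 \<le> ?r" by (simp add: sum_nonneg)
  have "norm (y k - y i) \<le> ?r" if "k < m" for k
    using that by (intro member_le_sum) auto
  then have "{k. k < m \<and> norm (y k - y i) \<le> ?r} = {..<m}" by auto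
  with assms show "real (card {k. k < m \<and> norm (y k - y i) \<le> ?r}) > real m / 2" by simp
qed

text \<open>The count is monotone in the radius, so the \<open>LEAST\<close> can be traded for a
  counting condition, which both the geometric and the measurability arguments need.\<close>

lemma radius_le_iff:
  fixes y :: "nat \<Rightarrow> 'a::euclidean_space"
  assumes "m > 0"
  shows "radius m y i \<le> r \<longleftrightarrow>
    r \<ge> 0 \<and> real (card {k. k < m \<and> norm (y k - y i) \<le> r}) > real m / 2"
proof
  obtain s where s: "s \<ge> 0" "real (card {k. k < m \<and> norm (y k - y i) \<le> s}) > real m / 2"
    using radius_ex[OF assms] by blast
  assume "radius m y i \<le> r"
  then have "card {k. k < m \<and> norm (y k - y i) \<le> radius m y i}
      \<le> card {k. k < m \<and> norm (y k - y i) \<le> r}"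
    by (intro card_mono) auto
  with radius_bounds[OF s] \<open>radius m y i \<le> r\<close>
  show "r \<ge> 0 \<and> real (card {k. k < m \<and> norm (y k - y i) \<le> r}) > real m / 2"
    by linarith
qed (use radius_bounds in auto)

lemma is_arg_min_arg_min_radius:
  assumes "m > 0"
  shows "is_arg_min (radius m y) (\<lambda>i. i < m) (ARG_MIN (radius m y) i. i < m)"
proof -
  have "\<exists>i. is_arg_min (radius m y) (\<lambda>i. i < m) i"
    using ex_is_arg_min_if_finite[of "{..<m}" "radius m y"] assms by auto
  then show ?thesis
    unfolding arg_min_def by (rule someI_ex)
qed

lemma two_majorities_meet:
  assumes "real (card A) > real m / 2" "real (card B) > real m / 2" "A \<subseteq> {..<m}" "B \<subseteq> {..<m}"
  shows "A \<inter> B \<noteq> {}"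
proof
  assume "A \<inter> B = {}"
  then have "card A + card B = card (A \<union> B)"
    using assms(3,4) by (intro card_Un_disjoint[symmetric]) (auto intro: finite_subset)
  also have "\<dots> \<le> m"
    using card_mono[of "{..<m}" "A \<union> B"] assms(3,4) by simp
  finally show False using assms(1,2) by linarith
qed

lemma select_close:
  fixes y :: "nat \<Rightarrow> 'a::euclidean_space"
  assumes "real (card {k. k < m \<and> norm (y k - c) \<le> e}) > real m / 2"
  shows "norm (select m y - c) \<le> 3 * e"
proof -
  define A where "A = {k. k < m \<and> norm (y k - c) \<le> e}"
  have A: "A \<subseteq> {..<m}" by (auto simp: A_def)
  have "A \<noteq> {}" using assms by (auto simp: A_def[symmetric])
  then obtain i where i: "i < m" "norm (y i - c) \<le> e" by (auto simp: A_def)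
  then have "e \<ge> 0" "m > 0" using norm_ge_zero order_trans by (blast, simp)
  have "norm (y k - y i) \<le> 2 * e" if "k \<in> A" for k
    using that i(2) norm_triangle_ineq4[of "y k - c" "y i - c"] by (simp add: A_def)
  then have "card A \<le> card {k. k < m \<and> norm (y k - y i) \<le> 2 * e}"
    by (intro card_mono) (auto simp: A_def)
  \<comment> \<open>Any sample \<open>i\<close> within \<open>e\<close> of \<open>c\<close> is
    within \<open>2 * e\<close> of the whole majority near \<open>c\<close>. The selected index
    \<open>j\<close> has the smallest radius, hence inherits this bound.\<close>
  then have ri: "radius m y i \<le> 2 * e"
    using assms \<open>m > 0\<close> \<open>e \<ge> 0\<close> by (subst radius_le_iff) (auto simp: A_def[symmetric])
  define j where "j = (ARG_MIN (radius m y) i. i < m)"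
  have j: "radius m y j \<le> 2 * e"
    using is_arg_min_arg_min_radius[OF \<open>m > 0\<close>, of y] i(1) ri
    unfolding is_arg_min_linorder j_def by force
  define B where "B = {k. k < m \<and> norm (y k - y j) \<le> 2 * e}"
  have "real (card B) > real m / 2"
    using j \<open>m > 0\<close> by (simp add: radius_le_iff B_def)
  \<comment> \<open>A sample common to both majorities links \<open>c\<close> to the selected point:
    \<open>e\<close> on one side and \<open>2 * e\<close> on the other.\<close>
  then have "A \<inter> B \<noteq> {}"
    by (intro two_majorities_meet[of m]) (use assms in \<open>auto simp: A_def B_def\<close>)
  then obtain k where k: "norm (y k - c) \<le> e" "norm (y k - y j) \<le> 2 * e"
    by (auto simp: A_def B_def)
  have "norm (y j - c) \<le> norm (y k - c) + norm (y k - y j)"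
    using norm_triangle_ineq4[of "y k - c" "y k - y j"] by simp
  with k show ?thesis by (simp add: select_def j_def)
qed

section \<open>Measurability of the selected sample\<close>

lemma radius_measurable:
  assumes "m > 0" and "i < m"
  shows "(\<lambda>y. radius m y i) \<in> borel_measurable (PiM {..<m} (\<lambda>_. borel :: 'a::euclidean_space measure))"
proof (subst borel_measurable_iff_le, intro allI)
  fix r :: real
  let ?M = "PiM {..<m} (\<lambda>_. borel :: 'a measure)"
  have [measurable]: "(\<lambda>y. y k) \<in> ?M \<rightarrow>\<^sub>M borel" if "k < m" for k
    using that by (intro measurable_component_singleton) simp
  \<comment> \<open>Written as a finite sum of indicators, the count is visibly measurable in
    \<open>y\<close>.\<close>
  have "real (card {k. k < m \<and> norm (y k - y i) \<le> r})
      = (\<Sum>k<m. indicator {..r} (norm (y k - y i)))" for y :: "nat \<Rightarrow> 'a"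
  proof -
    have "{k. k < m \<and> norm (y k - y i) \<le> r} = {..<m} \<inter> {k. norm (y k - y i) \<le> r}" by auto
    then show ?thesis by (simp add: indicator_def of_bool_def sum.If_cases)
  qed
  then have "{y \<in> space ?M. radius m y i \<le> r} = {y \<in> space ?M. r \<ge> 0 \<and>
      (\<Sum>k<m. indicator {..r} (norm (y k - y i))) > real m / 2}"
    using assms(1) by (simp add: radius_le_iff)
  also have "\<dots> \<in> sets ?M"
    using assms(2) by measurable
  finally show "{y \<in> space ?M. radius m y i \<le> r} \<in> sets ?M" .
qed

text \<open>The choice made by \<open>ARG_MIN\<close> among several minimizers depends only on the set of
  minimizing indices, hence takes finitely many values on measurable pieces.\<close>

lemma select_measurable:
  assumes "m > 0"
  shows "select m \<in> PiM {..<m} (\<lambda>_. borel :: 'a::euclidean_space measure) \<rightarrow>\<^sub>M borel"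
proof -
  let ?M = "PiM {..<m} (\<lambda>_. borel :: 'a measure)"
  define S where "S = (\<lambda>y :: nat \<Rightarrow> 'a. {i \<in> {..<m}. \<forall>j\<in>{..<m}. radius m y i \<le> radius m y j})"
  define c where "c = (\<lambda>A :: nat set. SOME i. i \<in> A)"
  have select_eq: "select m y = y (c (S y))" for y
    by (simp add: select_def arg_min_def is_arg_min_linorder S_def c_def Ball_def)
  have S: "S y \<noteq> {}" for y
    using is_arg_min_arg_min_radius[OF assms, of y]
    by (auto simp: S_def is_arg_min_linorder)
  have c: "c A < m" if "A \<in> Pow {..<m} - {{}}" for A
    using that some_in_eq[of A] by (auto simp: c_def)
  have [measurable]: "Measurable.pred ?M (\<lambda>y. radius m y i \<le> radius m y j)"
    if "i \<in> {..<m}" "j \<in> {..<m}" for i j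
    using that unfolding pred_def by (intro borel_measurable_le radius_measurable assms) auto
  have S_meas: "S \<in> ?M \<rightarrow>\<^sub>M count_space (Pow {..<m} - {{}})"
  proof (rule measurable_count_space_eq2[THEN iffD2], simp, intro conjI ballI)
    show "S \<in> space ?M \<rightarrow> Pow {..<m} - {{}}"
      using S by (auto simp: S_def)
  next
    fix A assume A: "A \<in> Pow {..<m} - {{}}"
    then have "S -` {A} \<inter> space ?M = {y \<in> space ?M. \<forall>i\<in>{..<m}.
        i \<in> A \<longleftrightarrow> (\<forall>j\<in>{..<m}. radius m y i \<le> radius m y j)}"
      unfolding S_def by auto
    also have "\<dots> \<in> sets ?M"
      by measurable
    finally show "S -` {A} \<inter> space ?M \<in> sets ?M" .
  qed
  have "(\<lambda>y. y (c (S y))) \<in> ?M \<rightarrow>\<^sub>M borel"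
  proof (rule measurable_compose_countable'[OF _ S_meas])
    show "(\<lambda>y. y (c A)) \<in> ?M \<rightarrow>\<^sub>M borel" if "A \<in> Pow {..<m} - {{}}" for A
      using c[OF that] by (intro measurable_component_singleton) simp
    show "countable (Pow {..<m} - {{}})"
      by (intro countable_finite) simp
  qed
  then show ?thesis
    by (simp add: select_eq[abs_def])
qed

subsection \<open>Repeated independent calls\<close>

text \<open>Joint laws of independent calls depend measurably on the input point. It suffices to
  test rectangles, an intersection-stable generator, on which the product measure is a finite
  product of measurable functions.\<close>

lemma measurable_PiM_prob_algebra:
  assumes "finite I" and K: "K \<in> M \<rightarrow>\<^sub>M prob_algebra N"
  shows "(\<lambda>x. PiM I (\<lambda>_. K x)) \<in> M \<rightarrow>\<^sub>M prob_algebra (PiM I (\<lambda>_. N))"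
proof (rule measurable_prob_algebra_generated[OF sets_PiM Int_stable_prod_algebra
      prod_algebra_sets_into_space])
  have prob: "prob_space (K x)" and sets: "sets (K x) = sets N" if "x \<in> space M" for x
    using measurable_space[OF K that] by (auto simp: space_prob_algebra)
  show "prob_space (PiM I (\<lambda>_. K x))" if "x \<in> space M" for x
    using prob[OF that] by (intro prob_space_PiM)
  show "sets (PiM I (\<lambda>_. K x)) = sets (PiM I (\<lambda>_. N))" if "x \<in> space M" for x
    using sets[OF that] by (intro sets_PiM_cong) auto
  fix A assume "A \<in> prod_algebra I (\<lambda>_. N)"
  then obtain X where A: "A = Pi\<^sub>E I X" and X: "\<And>i. i \<in> I \<Longrightarrow> X i \<in> sets N"
    unfolding prod_algebra_eq_finite[OF assms(1)] by blast
  have "emeasure (PiM I (\<lambda>_. K x)) A = (\<Prod>i\<in>I. emeasure (K x) (X i))" if "x \<in> space M" for x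
  proof -
    interpret prob_space "K x" using prob[OF that] .
    interpret product_sigma_finite "\<lambda>_. K x" by standard
    show ?thesis
      unfolding A using X sets[OF that] by (intro emeasure_PiM assms(1)) auto
  qed
  moreover have "(\<lambda>x. \<Prod>i\<in>I. emeasure (K x) (X i)) \<in> borel_measurable M"
    by (intro borel_measurable_prod_ennreal
        measurable_compose[OF measurable_prob_algebraD[OF K] measurable_emeasure_subprob_algebra] X)
  ultimately show "(\<lambda>x. emeasure (PiM I (\<lambda>_. K x)) A) \<in> borel_measurable M"
    by (subst measurable_cong)
qed

text \<open>The joint law of the coordinates is the product measure itself, since restriction to
  \<open>I\<close> is the identity on its extensional points, and each marginal is the corresponding
  factor.\<close>

lemma (in product_prob_space) indep_vars_components:
  assumes "I \<noteq> {}"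
  shows "P.indep_vars M (\<lambda>i \<omega>. \<omega> i) I"
proof -
  have "distr (PiM I M) (PiM I M) (\<lambda>\<omega>. \<lambda>i\<in>I. \<omega> i) = distr (PiM I M) (PiM I M) (\<lambda>\<omega>. \<omega>)"
    by (intro distr_cong) (auto simp: space_PiM PiE_def extensional_restrict)
  also have "\<dots> = PiM I M" by simp
  also have "\<dots> = PiM I (\<lambda>i. distr (PiM I M) (M i) (\<lambda>\<omega>. \<omega> i))"
    by (intro PiM_cong) (auto simp: PiM_component)
  finally show ?thesis
    using assms by (subst P.indep_vars_iff_distr_eq_PiM') auto
qed

text \<open>The expected number of hits is at least \<open>2 * m / 3\<close>, so missing the
  majority is a deviation of at least \<open>m / 6\<close>. Hoeffding's exponent
  \<open>2 * (m / 6)\<^sup>2 / m\<close> equals \<open>m / 18\<close>.\<close>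

lemma majority_probability:
  assumes "prob_space P" "A \<in> sets P" "measure P A \<ge> 2 / 3" "m > 0"
  shows "measure (PiM {..<m} (\<lambda>_. P))
      {y \<in> space (PiM {..<m} (\<lambda>_. P)). real (card {k. k < m \<and> y k \<in> A}) > real m / 2}
    \<ge> 1 - exp (- real m / 18)"
proof -
  interpret P: prob_space P by fact
  interpret PP: product_prob_space "\<lambda>_. P" "{..<m}" by standard
  let ?Q = "PiM {..<m} (\<lambda>_. P)"
  let ?X = "\<lambda>k y. indicator A (y k) :: real"
  have "PP.P.indep_vars (\<lambda>_. P) (\<lambda>k y. y k) {..<m}"
    using assms(4) by (intro PP.indep_vars_components) auto
  from PP.P.indep_vars_compose2[OF this, of "\<lambda>_. indicator A" "\<lambda>_. borel"]
  have indep: "PP.P.indep_vars (\<lambda>_. borel) ?X {..<m}"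
    using assms(2) by simp
  define \<nu> where "\<nu> = (\<Sum>k<m. PP.P.expectation (?X k))"
  interpret H: Hoeffding_ineq ?Q "{..<m}" ?X "\<lambda>_. 0" "\<lambda>_. 1" \<nu>
  proof unfold_locales
    show "PP.P.indep_vars (\<lambda>_. borel) ?X {..<m}" by (rule indep)
    show "AE y in ?Q. ?X k y \<in> {0..1}" if "k \<in> {..<m}" for k
      by (intro AE_I2) (auto simp: indicator_def)
  qed (simp_all add: \<nu>_def)
  have "PP.P.expectation (?X k) = measure P A" if "k < m" for k
  proof -
    have "PP.P.expectation (?X k) = (\<integral>x. indicator A x \<partial>distr ?Q P (\<lambda>y. y k))"
      using that assms(2) by (intro integral_distr[symmetric]) auto
    also have "distr ?Q P (\<lambda>y. y k) = P"
      using that by (simp add: PP.PiM_component)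
    finally show ?thesis using assms(2) by simp
  qed
  then have \<nu>: "\<nu> = m * measure P A" by (simp add: \<nu>_def)
  \<comment> \<open>Chosen so that the lower tail \<open>\<nu> - \<epsilon>\<close> is exactly the
    majority threshold.\<close>
  define \<epsilon> where "\<epsilon> = \<nu> - real m / 2"
  have \<epsilon>: "\<epsilon> \<ge> real m / 6"
    using mult_left_mono[OF assms(3), of "real m"] by (simp add: \<epsilon>_def \<nu> field_simps)
  have card_eq: "real (card {k. k < m \<and> y k \<in> A}) = (\<Sum>k<m. ?X k y)" for y
  proof -
    have "{k. k < m \<and> y k \<in> A} = {..<m} \<inter> {k. y k \<in> A}" by auto
    then show ?thesis by (simp add: indicator_def of_bool_def sum.If_cases)
  qed
  have "PP.P.prob {y \<in> space ?Q. (\<Sum>k<m. ?X k y) \<le> \<nu> - \<epsilon>} \<le> exp (- 2 * \<epsilon>\<^sup>2 / (\<Sum>k<m. (1 - 0)\<^sup>2))"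
    using \<epsilon> assms(4) by (intro H.Hoeffding_ineq_le) auto
  also have "\<dots> \<le> exp (- real m / 18)"
  proof -
    have "(real m / 6)\<^sup>2 \<le> \<epsilon>\<^sup>2"
      using \<epsilon> by (intro power_mono) auto
    then show ?thesis using assms(4) by (simp add: field_simps power2_eq_square)
  qed
  finally have "PP.P.prob {y \<in> space ?Q. (\<Sum>k<m. ?X k y) \<le> real m / 2} \<le> exp (- real m / 18)"
    by (simp add: \<epsilon>_def)
  moreover have "{y \<in> space ?Q. (\<Sum>k<m. ?X k y) > real m / 2}
      = space ?Q - {y \<in> space ?Q. (\<Sum>k<m. ?X k y) \<le> real m / 2}"
    by auto
  moreover have "{y \<in> space ?Q. (\<Sum>k<m. ?X k y) \<le> real m / 2} \<in> sets ?Q"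
    using H.random_variable by (intro borel_measurable_le borel_measurable_sum) auto
  ultimately show ?thesis
    unfolding card_eq by (simp add: PP.P.prob_compl)
qed

lemma select_probability:
  fixes c :: "'a::euclidean_space"
  assumes "P \<in> space (prob_algebra borel)" "measure P {y. norm (y - c) \<le> e} \<ge> 2 / 3" "m > 0"
  shows "measure (distr (PiM {..<m} (\<lambda>_. P)) borel (select m)) {y. norm (y - c) \<le> 3 * e}
    \<ge> 1 - exp (- real m / 18)"
proof -
  let ?Q = "PiM {..<m} (\<lambda>_. P)"
  have P: "prob_space P" "sets P = sets borel"
    using assms(1) by (auto simp: space_prob_algebra)
  interpret Q: prob_space ?Q
    using P(1) by (intro prob_space_PiM)
  have "sets ?Q = sets (PiM {..<m} (\<lambda>_. borel))"
    using P(2) by (intro sets_PiM_cong) auto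
  then have sel: "select m \<in> ?Q \<rightarrow>\<^sub>M borel"
    using select_measurable[OF assms(3)] by (simp cong: measurable_cong_sets)
  have ball: "{y. norm (y - c) \<le> r} \<in> sets borel" for r
    by (intro borel_closed closed_Collect_le continuous_intros)
  have "1 - exp (- real m / 18) \<le> Q.prob {y \<in> space ?Q.
      real (card {k. k < m \<and> y k \<in> {y. norm (y - c) \<le> e}}) > real m / 2}"
    using majority_probability[OF P(1) _ assms(2,3)] ball P(2) by simp
  also have "\<dots> \<le> Q.prob (select m -` {y. norm (y - c) \<le> 3 * e} \<inter> space ?Q)"
    using measurable_sets[OF sel ball] by (intro Q.finite_measure_mono) (auto intro: select_close)
  also have "\<dots> = measure (distr ?Q borel (select m)) {y. norm (y - c) \<le> 3 * e}"
    using sel ball by (simp add: measure_distr)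
  finally show ?thesis .
qed

section \<open>Accuracy of \<open>Alg_R\<close> and composition of random steps\<close>

lemma Alg_R_measurable:
  fixes Alg :: "'a::euclidean_space rand_proc"
  assumes "Alg \<delta> l \<Delta> \<in> borel \<rightarrow>\<^sub>M prob_algebra borel" "m > 0"
  shows "(\<lambda>x. Alg_R Alg \<delta> l \<Delta> x m) \<in> borel \<rightarrow>\<^sub>M prob_algebra borel"
  unfolding Alg_R_def
  using measurable_compose[OF measurable_PiM_prob_algebra[OF finite_lessThan assms(1)]
      measurable_distr_prob_space[OF select_measurable[OF assms(2)]]] .

text \<open>Strong convexity turns the accuracy \<open>\<delta> / 9\<close> in value into a distance \<open>e\<close> with
  \<open>9 * e\<^sup>2 = 2 * \<delta> / (\<mu> + l)\<close>, which absorbs the loss of the factor \<open>3\<close> when selecting.\<close>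

lemma Alg_R_probability:
  fixes f :: "'a::euclidean_space \<Rightarrow> real"
  assumes "is_Alg f Alg" "\<mu> + l > 0" "\<delta> > 0" "l \<ge> 0" "\<Delta> > 0" "m > 0"
    and "f x - min_val (prox f l x) \<le> \<Delta>"
    and "min_val (prox f l x) = prox f l x z"
    and lower: "\<And>y. (\<mu> + l) / 2 * (norm (y - z))\<^sup>2 \<le> prox f l x y - prox f l x z"
  shows "measure (Alg_R Alg (\<delta> / 9) l \<Delta> x m) {y. (norm (y - z))\<^sup>2 \<le> 2 * \<delta> / (\<mu> + l)}
    \<ge> 1 - exp (- real m / 18)"
proof -
  define e where "e = sqrt (2 * \<delta> / (9 * (\<mu> + l)))"
  have alg: "Alg (\<delta> / 9) l \<Delta> \<in> borel \<rightarrow>\<^sub>M prob_algebra borel"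
    and good: "2 / 3 \<le> measure (Alg (\<delta> / 9) l \<Delta> x)
      {y. prox f l x y - min_val (prox f l x) \<le> \<delta> / 9}"
  proof -
    have "prox f l x x - min_val (prox f l x) \<le> \<Delta>"
      using assms(7) by (simp add: prox_def)
    with assms(1,3,4,5) show "Alg (\<delta> / 9) l \<Delta> \<in> borel \<rightarrow>\<^sub>M prob_algebra borel"
      "2 / 3 \<le> measure (Alg (\<delta> / 9) l \<Delta> x)
        {y. prox f l x y - min_val (prox f l x) \<le> \<delta> / 9}"
      unfolding is_Alg_def by (metis divide_pos_pos zero_less_numeral)+
  qed
  have mem: "Alg (\<delta> / 9) l \<Delta> x \<in> space (prob_algebra borel)"
    using measurable_space[OF alg] by simp
  then interpret A: prob_space "Alg (\<delta> / 9) l \<Delta> x" by (simp add: space_prob_algebra)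
  have "norm (y - z) \<le> e" if "prox f l x y - min_val (prox f l x) \<le> \<delta> / 9" for y
  proof -
    have "(\<mu> + l) / 2 * (norm (y - z))\<^sup>2 \<le> \<delta> / 9"
      using lower[of y] that assms(8) by simp
    then have "(norm (y - z))\<^sup>2 \<le> 2 * \<delta> / (9 * (\<mu> + l))"
      using assms(2) by (simp add: field_simps)
    then show ?thesis
      unfolding e_def by (rule real_le_rsqrt)
  qed
  then have "2 / 3 \<le> A.prob {y. norm (y - z) \<le> e}"
    using mem by (intro order_trans[OF good] A.finite_measure_mono)
      (auto simp: space_prob_algebra intro!: borel_closed closed_Collect_le continuous_intros)
  from select_probability[OF mem this assms(6)]
  have "1 - exp (- real m / 18) \<le> measure (Alg_R Alg (\<delta> / 9) l \<Delta> x m) {y. norm (y - z) \<le> 3 * e}"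
    by (simp add: Alg_R_def)
  also have "{y. norm (y - z) \<le> 3 * e} = {y. (norm (y - z))\<^sup>2 \<le> 2 * \<delta> / (\<mu> + l)}"
  proof -
    have "3 * e \<ge> 0" "(3 * e)\<^sup>2 = 2 * \<delta> / (\<mu> + l)"
      using assms(2,3) by (auto simp: e_def power_mult_distrib divide_simps)
    then show ?thesis
      by (metis abs_le_square_iff abs_norm_cancel abs_of_nonneg)
  qed
  finally show ?thesis .
qed

text \<open>Success in two stages: \<open>b * indicator A\<close> is a pointwise lower bound for the
  success probability of the second stage, and integrating it over the first gives the
  product.\<close>

lemma measure_bind_ge:
  assumes M: "M \<in> space (prob_algebra N)" and K: "K \<in> N \<rightarrow>\<^sub>M prob_algebra N'"
    and A: "A \<in> sets N" and B: "B \<in> sets N'"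
    and M_A: "measure M A \<ge> a" and K_B: "\<And>x. x \<in> A \<Longrightarrow> measure (K x) B \<ge> b" and "b \<ge> 0"
  shows "measure (M \<bind> K) B \<ge> a * b"
proof -
  interpret M: prob_space M using M by (simp add: space_prob_algebra)
  have sets_M: "sets M = sets N" using M by (simp add: space_prob_algebra)
  interpret MK: prob_space "M \<bind> K" using M K by (rule prob_space_bind')
  have "ennreal (b * measure M A) = (\<integral>\<^sup>+x. ennreal b * indicator A x \<partial>M)"
    using A sets_M \<open>b \<ge> 0\<close>
    by (simp add: nn_integral_cmult_indicator M.emeasure_eq_measure ennreal_mult)
  also have "\<dots> \<le> (\<integral>\<^sup>+x. emeasure (K x) B \<partial>M)"
  proof (rule nn_integral_mono)
    fix x assume "x \<in> space M"
    then have "x \<in> space N" using sets_eq_imp_space_eq[OF sets_M] by simp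
    then interpret K: prob_space "K x"
      using measurable_space[OF K] by (simp add: space_prob_algebra)
    show "ennreal b * indicator A x \<le> emeasure (K x) B"
      using K_B[of x] by (auto simp: indicator_def K.emeasure_eq_measure intro: ennreal_leI)
  qed
  also have "\<dots> = measure (M \<bind> K) B"
    using emeasure_bind_prob_algebra[OF M K B] by (simp add: MK.emeasure_eq_measure)
  finally have "b * measure M A \<le> measure (M \<bind> K) B" by simp
  with mult_left_mono[OF M_A \<open>b \<ge> 0\<close>] show ?thesis by (simp add: mult.commute)
qed

subsection \<open>The inexact proximal point iteration\<close>

text \<open>In this lemma and the next, \<open>c\<close> stands for the accuracy divided by the
  strong convexity constant of the regularized function.\<close>

lemma inexact_prox_value:
  fixes f :: "'a::euclidean_space \<Rightarrow> real"
  assumes "l \<ge> 0" "L + l > 0" "min_val (prox f l x) = prox f l x z"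
    and "prox f l x y - prox f l x z \<le> (L + l) / 2 * (norm (y - z))\<^sup>2"
    and "(norm (y - z))\<^sup>2 \<le> 2 * c"
  shows "f y \<le> min_val (prox f l x) + (L + l) * c"
proof -
  have "f y \<le> prox f l x y" using assms(1) by (simp add: prox_def)
  moreover have "(L + l) / 2 * (norm (y - z))\<^sup>2 \<le> (L + l) / 2 * (2 * c)"
    using assms(2,5) by (intro mult_left_mono) auto
  ultimately show ?thesis using assms(3,4) by simp
qed

text \<open>The next regularized function is tested at the previous exact minimizer
  \<open>z\<close>, not at \<open>y\<close>. Only the new penalty is paid, so no factor
  \<open>L\<close> enters the accumulated error.\<close>

lemma inexact_prox_next_min:
  fixes f :: "'a::euclidean_space \<Rightarrow> real"
  assumes "\<mu> > 0" "strongly_convex \<mu> f" "smooth L f" "l \<ge> 0" "l' \<ge> 0"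
    and "min_val (prox f l x) = prox f l x z"
    and "(norm (y - z))\<^sup>2 \<le> 2 * c"
  shows "min_val (prox f l' y) \<le> min_val (prox f l x) + l' * c"
proof -
  have "min_val (prox f l' y) \<le> f z + l' / 2 * (norm (y - z))\<^sup>2"
    using min_val_prox_le[OF assms(1-3,5), of y z] by (simp add: prox_def norm_minus_commute)
  also have "l' / 2 * (norm (y - z))\<^sup>2 \<le> l' / 2 * (2 * c)"
    using assms(5,7) by (intro mult_left_mono) auto
  also have "f z \<le> prox f l x z"
    using assms(4) by (simp add: prox_def)
  finally show ?thesis using assms(6) by simp
qed

text \<open>Carrying the bound on the next regularized minimum along makes this invariant of the
  iterate with index \<open>j - 1\<close> depend on that iterate only, although the argument refers to the
  previous exact minimizer.\<close>

definition boost_good ::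
  "('a::euclidean_space \<Rightarrow> real) \<Rightarrow> real \<Rightarrow> real \<Rightarrow> (nat \<Rightarrow> real) \<Rightarrow> real \<Rightarrow> real \<Rightarrow> nat \<Rightarrow> 'a set" where
  "boost_good f \<mu> L lam \<delta> \<Delta>in j =
     {x. f x - min_val f \<le> prev \<Delta>in (boost_gap \<mu> L lam \<delta>) j \<and>
         min_val (prox f (prev 0 lam j) x) - min_val f
           \<le> \<delta> * (\<Sum>i<j. lam i / (\<mu> + prev 0 lam i))}"

lemma prev_simps [simp]: "prev a s 0 = a" "prev a s (Suc j) = s j"
  by (simp_all add: prev_def)

lemma prev_nonneg:
  fixes lam :: "nat \<Rightarrow> real"
  assumes "\<And>i. i \<le> T \<Longrightarrow> 0 \<le> lam i" "j \<le> Suc T"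
  shows "0 \<le> prev 0 lam j"
  using assms by (cases j) auto

text \<open>The guarantee of \<open>Alg\<close> is available only for positive gap bounds.\<close>

lemma boost_gap_pos:
  assumes "0 < \<mu>" "0 < L" "0 < \<delta>" "\<And>i. i \<le> T \<Longrightarrow> 0 \<le> lam i" "j \<le> T"
  shows "0 < boost_gap \<mu> L lam \<delta> j"
proof -
  have nonneg: "0 \<le> prev 0 lam i" if "i \<le> j" for i
    using prev_nonneg[of T lam i] that assms(4,5) by simp
  have "0 \<le> (\<Sum>i<j. lam i / (\<mu> + prev 0 lam i))"
    using assms nonneg by (intro sum_nonneg divide_nonneg_nonneg add_nonneg_nonneg) auto
  moreover have "0 < (L + prev 0 lam j) / (\<mu> + prev 0 lam j)"
    using assms(1,2) nonneg[of j] by (intro divide_pos_pos) auto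
  ultimately show ?thesis
    using assms(3) by (simp add: boost_gap_def)
qed

lemma boost_good_sets:
  assumes "\<mu> > 0" "strongly_convex \<mu> f" "smooth L f" "0 \<le> prev 0 lam j"
  shows "boost_good f \<mu> L lam \<delta> \<Delta>in j \<in> sets borel"
proof -
  have [measurable]: "f \<in> borel_measurable borel"
    by (intro borel_measurable_continuous_onI smooth_imp_continuous_on[OF assms(3)])
  have [measurable]: "(\<lambda>x. min_val (prox f (prev 0 lam j) x)) \<in> borel_measurable borel"
    using assms by (rule min_val_prox_measurable)
  show ?thesis
    unfolding boost_good_def by measurable
qed

text \<open>One call of \<open>Alg_R\<close> with a general target accuracy \<open>\<eta>\<close>,
  so that it covers the loop, where \<open>\<eta>\<close> is \<open>\<delta>\<close>, as well as the
  more accurate final call. The premise \<open>imp\<close> hides the exact minimizer, leaving an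
  event \<open>B\<close> on the output alone.\<close>

lemma boost_step_probability:
  fixes f :: "'a::euclidean_space \<Rightarrow> real"
  assumes f: "\<mu> > 0" "strongly_convex \<mu> f" "smooth L f" and alg: "is_Alg f Alg"
    and "\<eta> > 0" "m > 0" "l \<ge> 0" "\<Delta> > 0" and gap: "f x - min_val f \<le> \<Delta>"
    and B: "B \<in> sets borel"
    and imp: "\<And>y z. min_val (prox f l x) = prox f l x z \<Longrightarrow>
      f y \<le> min_val (prox f l x) + (L + l) * (\<eta> / (\<mu> + l)) \<Longrightarrow>
      (norm (y - z))\<^sup>2 \<le> 2 * (\<eta> / (\<mu> + l)) \<Longrightarrow> y \<in> B"
  shows "measure (Alg_R Alg (\<eta> / 9) l \<Delta> x m) B \<ge> 1 - exp (- real m / 18)"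
proof -
  obtain z where z: "min_val (prox f l x) = prox f l x z"
    and lower: "\<And>y. (\<mu> + l) / 2 * (norm (y - z))\<^sup>2 \<le> prox f l x y - prox f l x z"
    and upper: "\<And>y. prox f l x y - prox f l x z \<le> (L + l) / 2 * (norm (y - z))\<^sup>2"
    using prox_minimizer[OF f \<open>l \<ge> 0\<close>] by metis
  have pos: "\<mu> + l > 0" "L + l > 0"
    using strongly_convex_smooth_le[OF f] f(1) \<open>l \<ge> 0\<close> by auto
  have kernel: "(\<lambda>x. Alg_R Alg (\<eta> / 9) l \<Delta> x m) \<in> borel \<rightarrow>\<^sub>M prob_algebra borel"
    using alg assms by (intro Alg_R_measurable) (auto simp: is_Alg_def)
  from measurable_space[OF this, of x]
  have R: "prob_space (Alg_R Alg (\<eta> / 9) l \<Delta> x m)" "sets (Alg_R Alg (\<eta> / 9) l \<Delta> x m) = sets borel"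
    by (auto simp: space_prob_algebra)
  interpret R: prob_space "Alg_R Alg (\<eta> / 9) l \<Delta> x m" by (rule R)
  have "f x - min_val (prox f l x) \<le> \<Delta>"
    using min_val_le_min_val_prox[OF f \<open>l \<ge> 0\<close>, of x] gap by linarith
  then have "1 - exp (- real m / 18) \<le> R.prob {y. (norm (y - z))\<^sup>2 \<le> 2 * \<eta> / (\<mu> + l)}"
    using assms by (intro Alg_R_probability[OF alg pos(1) _ _ _ _ _ z lower]) auto
  also have "\<dots> \<le> R.prob B"
  proof (rule R.finite_measure_mono[OF subsetI])
    show "B \<in> R.events" using B R(2) by simp
  next
    fix y assume "y \<in> {y. (norm (y - z))\<^sup>2 \<le> 2 * \<eta> / (\<mu> + l)}"
    then have "(norm (y - z))\<^sup>2 \<le> 2 * (\<eta> / (\<mu> + l))" by simp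
    then show "y \<in> B"
      using imp[OF z] inexact_prox_value[OF \<open>l \<ge> 0\<close> pos(2) z upper] by blast
  qed
  finally show ?thesis .
qed

lemma boost_iter_probability:
  fixes f :: "'a::euclidean_space \<Rightarrow> real"
  assumes f: "\<mu> > 0" "strongly_convex \<mu> f" "smooth L f" and alg: "is_Alg f Alg"
    and "\<Delta>in > 0" "f xin - min_val f \<le> \<Delta>in" "\<delta> > 0" "m > 0"
    and lam: "\<And>i. i \<le> T \<Longrightarrow> 0 \<le> lam i" and "j \<le> Suc T"
  shows "boost_iter Alg \<mu> L lam \<delta> \<Delta>in xin m j \<in> space (prob_algebra borel)"
    and "measure (boost_iter Alg \<mu> L lam \<delta> \<Delta>in xin m j) (boost_good f \<mu> L lam \<delta> \<Delta>in j)
      \<ge> 1 - real j * exp (- real m / 18)"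
proof -
  define p where "p = exp (- real m / 18)"
  have p: "0 \<le> p" "p \<le> 1" by (auto simp: p_def)
  have "L > 0"
    using strongly_convex_smooth_le[OF f] f(1) by simp
  let ?G = "boost_good f \<mu> L lam \<delta> \<Delta>in"
  let ?X = "boost_iter Alg \<mu> L lam \<delta> \<Delta>in xin m"
  have G_sets: "?G j \<in> sets borel" if "j \<le> Suc T" for j
    using f prev_nonneg[OF lam that] by (rule boost_good_sets) auto
  have "?X j \<in> space (prob_algebra borel) \<and> measure (?X j) (?G j) \<ge> 1 - real j * p"
    if "j \<le> Suc T" for j
    using that
  proof (induction j)
    case 0
    \<comment> \<open>The penalty with index -1 is 0, so at the start the regularized minimum is the
      minimum of \<open>f\<close> and the error sum is empty.\<close>
    have "prox f 0 xin = f" by (simp add: prox_def fun_eq_iff)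
    then have "xin \<in> ?G 0"
      using assms(6) by (simp add: boost_good_def)
    then show ?case
      using G_sets[of 0] by (simp add: space_prob_algebra prob_space_return measure_return)
  next
    case (Suc j)
    define l where "l = prev 0 lam j"
    define \<Delta> where "\<Delta> = prev \<Delta>in (boost_gap \<mu> L lam \<delta>) j"
    have "j \<le> T" using Suc.prems by simp
    have "l \<ge> 0" using prev_nonneg[OF lam, of j] Suc.prems by (simp add: l_def)
    have "\<Delta> > 0"
      using \<open>j \<le> T\<close> assms(5) boost_gap_pos[OF f(1) \<open>L > 0\<close> \<open>\<delta> > 0\<close> lam]
      by (cases j) (auto simp: \<Delta>_def)
    define K where "K = (\<lambda>x. Alg_R Alg (\<delta> / 9) l \<Delta> x m)"
    have K: "K \<in> borel \<rightarrow>\<^sub>M prob_algebra borel"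
      unfolding K_def using alg \<open>l \<ge> 0\<close> \<open>\<Delta> > 0\<close> \<open>\<delta> > 0\<close> \<open>m > 0\<close>
      by (intro Alg_R_measurable) (auto simp: is_Alg_def)
    have X_Suc: "?X (Suc j) = ?X j \<bind> K"
      by (simp add: K_def l_def \<Delta>_def)
    have IH: "?X j \<in> space (prob_algebra borel)" "measure (?X j) (?G j) \<ge> 1 - real j * p"
      using Suc by auto
    have step: "measure (K x) (?G (Suc j)) \<ge> 1 - p" if "x \<in> ?G j" for x
      unfolding K_def p_def
    proof (rule boost_step_probability[OF f alg \<open>\<delta> > 0\<close> \<open>m > 0\<close> \<open>l \<ge> 0\<close> \<open>\<Delta> > 0\<close>])
      show "f x - min_val f \<le> \<Delta>"
        using that by (simp add: boost_good_def \<Delta>_def)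
      show "?G (Suc j) \<in> sets borel"
        using G_sets Suc.prems by blast
      fix y z
      assume z: "min_val (prox f l x) = prox f l x z"
        and y: "f y \<le> min_val (prox f l x) + (L + l) * (\<delta> / (\<mu> + l))"
          "(norm (y - z))\<^sup>2 \<le> 2 * (\<delta> / (\<mu> + l))"
      have bound: "min_val (prox f l x) - min_val f \<le> \<delta> * (\<Sum>i<j. lam i / (\<mu> + prev 0 lam i))"
        using that by (simp add: boost_good_def l_def)
      have "min_val (prox f (lam j) y) \<le> min_val (prox f l x) + lam j * (\<delta> / (\<mu> + l))"
        using inexact_prox_next_min[OF f \<open>l \<ge> 0\<close> lam[OF \<open>j \<le> T\<close>] z y(2)] .
      \<comment> \<open>The value bound for \<open>y\<close> yields \<open>boost_gap\<close> at
        \<open>j\<close>, and the bound on the next minimum adds the summand with index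
        \<open>j\<close>.\<close>
      with bound y(1) show "y \<in> ?G (Suc j)"
        by (simp add: boost_good_def boost_gap_def l_def[symmetric] distrib_left mult.commute)
    qed
    \<comment> \<open>The two sides differ by \<open>j * p\<^sup>2\<close>. The first factor on the
      right may be negative; \<open>measure_bind_ge\<close> asks only that the second is
      not.\<close>
    have "1 - real (Suc j) * p \<le> (1 - real j * p) * (1 - p)"
      using p by (simp add: algebra_simps)
    also have "\<dots> \<le> measure (?X j \<bind> K) (?G (Suc j))"
      using IH K G_sets Suc.prems step p by (intro measure_bind_ge) auto
    finally show ?case
      using prob_space_bind'[OF IH(1) K] sets_bind'[OF IH(1) K]
      unfolding X_Suc by (simp add: space_prob_algebra)
  qed
  then show "?X j \<in> space (prob_algebra borel)" "measure (?X j) (?G j) \<ge> 1 - real j * exp (- real m / 18)"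
    using assms(10) by (auto simp: p_def)
qed

theorem theorem5p2:
  fixes f :: "'a::euclidean_space \<Rightarrow> real" and Alg :: "'a rand_proc"
    and \<mu> L \<delta> \<Delta>in :: real and xin :: 'a and T m :: nat and lam :: "nat \<Rightarrow> real"
  assumes "\<mu> > 0" and "strongly_convex \<mu> f" and "smooth L f"
    and "is_Alg f Alg"
    and "\<Delta>in > 0" and "\<Delta>in \<ge> f xin - min_val f"
    and "\<delta> > 0"
    and "0 \<le> lam 0" and "\<And>j. j < T \<Longrightarrow> lam j \<le> lam (Suc j)"
  shows "measure (BoostAlg Alg \<mu> L lam \<delta> \<Delta>in xin T m)
           {x. f x - min_val f \<le> \<delta> * (1 + (\<Sum>i\<le>T. lam i / (\<mu> + prev 0 lam i)))}
         \<ge> 1 - (real T + 2) * exp (- real m / 18)"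
proof (cases "m = 0")
  \<comment> \<open>Without samples the claimed probability bound is \<open>- T - 1\<close>, hence
    trivial.\<close>
  case True
  then show ?thesis
    by (intro order_trans[OF _ measure_nonneg]) simp
next
  case False
  then have "m > 0" by simp
  note f = assms(1-3)
  have "L > 0"
    using strongly_convex_smooth_le[OF f] f(1) by simp
  have lam: "0 \<le> lam i" if "i \<le> T" for i
    using that
  proof (induction i)
    case (Suc i)
    then show ?case using assms(9)[of i] by simp
  qed (use assms(8) in simp)
  define p where "p = exp (- real m / 18)"
  have p: "0 \<le> p" "p \<le> 1" by (auto simp: p_def)
  define l where "l = lam T"
  define \<Delta> where "\<Delta> = boost_gap \<mu> L lam \<delta> T"
  have "l \<ge> 0" using lam by (simp add: l_def)
  have "\<Delta> > 0" using boost_gap_pos[OF f(1) \<open>L > 0\<close> \<open>\<delta> > 0\<close> lam] by (simp add: \<Delta>_def)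
  \<comment> \<open>The final accuracy is scaled so that the smoothness loss
    \<open>(L + l) / (\<mu> + l)\<close> cancels, leaving the summand 1 of the claim in place of a
    condition number.\<close>
  define \<eta> where "\<eta> = (\<mu> + l) / (L + l) * \<delta>"
  have "\<eta> > 0"
    using f(1) \<open>L > 0\<close> \<open>l \<ge> 0\<close> \<open>\<delta> > 0\<close> by (auto simp: \<eta>_def intro!: mult_pos_pos divide_pos_pos)
  have \<eta>: "(L + l) * (\<eta> / (\<mu> + l)) = \<delta>"
    using f(1) \<open>L > 0\<close> \<open>l \<ge> 0\<close> by (simp add: \<eta>_def)
  define K where "K = (\<lambda>x. Alg_R Alg (\<eta> / 9) l \<Delta> x m)"
  have K: "K \<in> borel \<rightarrow>\<^sub>M prob_algebra borel"
    unfolding K_def using assms(4) \<open>l \<ge> 0\<close> \<open>\<Delta> > 0\<close> \<open>\<eta> > 0\<close> \<open>m > 0\<close>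
    by (intro Alg_R_measurable) (auto simp: is_Alg_def)
  \<comment> \<open>Because of the index shift this is the law of the iterate with index
    \<open>T\<close>, and \<open>?G\<close> bounds its gap by \<open>boost_gap\<close> at
    \<open>T\<close> and its regularized minimum by the sum up to \<open>T\<close>.\<close>
  let ?X = "boost_iter Alg \<mu> L lam \<delta> \<Delta>in xin m (Suc T)"
  let ?G = "boost_good f \<mu> L lam \<delta> \<Delta>in (Suc T)"
  let ?B = "{x. f x - min_val f \<le> \<delta> * (1 + (\<Sum>i\<le>T. lam i / (\<mu> + prev 0 lam i)))}"
  have B_sets: "?B \<in> sets borel"
    by (intro borel_closed closed_Collect_le continuous_intros smooth_imp_continuous_on[OF f(3)])
  have X: "?X \<in> space (prob_algebra borel)" "measure ?X ?G \<ge> 1 - real (Suc T) * p"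
    using boost_iter_probability[OF f assms(4,5,6,7) \<open>m > 0\<close> lam order.refl]
    by (auto simp: p_def)
  have step: "measure (K x) ?B \<ge> 1 - p" if "x \<in> ?G" for x
    unfolding K_def p_def
  proof (rule boost_step_probability[OF f assms(4) \<open>\<eta> > 0\<close> \<open>m > 0\<close> \<open>l \<ge> 0\<close> \<open>\<Delta> > 0\<close>])
    show "f x - min_val f \<le> \<Delta>"
      using that by (simp add: boost_good_def \<Delta>_def)
    fix y
    assume "f y \<le> min_val (prox f l x) + (L + l) * (\<eta> / (\<mu> + l))"
    moreover have "min_val (prox f l x) - min_val f
        \<le> \<delta> * (\<Sum>i\<le>T. lam i / (\<mu> + prev 0 lam i))"
      using that by (simp add: boost_good_def l_def lessThan_Suc_atMost)
    ultimately show "y \<in> ?B"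
      unfolding \<eta> by (simp add: distrib_left)
  qed (rule B_sets)
  have "1 - (real T + 2) * p \<le> (1 - real (Suc T) * p) * (1 - p)"
    using p by (simp add: algebra_simps)
  also have "\<dots> \<le> measure (?X \<bind> K) ?B"
    using K X B_sets step p boost_good_sets[OF f, where lam = lam and j = "Suc T"] lam[of T]
    by (intro measure_bind_ge) auto
  also have "?X \<bind> K = BoostAlg Alg \<mu> L lam \<delta> \<Delta>in xin T m"
    by (simp add: BoostAlg_def K_def \<eta>_def l_def \<Delta>_def)
  finally show ?thesis by (simp add: p_def)
qed

end
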